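(* For every integer $n\geq 4$, $\Gamma_b(C_n)=2\left(\left\lfloor\frac{n}{2}\right\rfloor-1\right)$, where $C_n$ is the cycle of order $n$.
   Context: For a graph $G=(V,E)$, a broadcast is a function $f:V\to\{0,\dots,\operatorname{diam}(G)\}$ with $f(v)\le e_G(v)$ (eccentricity) for all $v$. Let $V^+_f=\{v: f(v)>0\}$ and $H_f(u)=\{v\in V^+_f: d_G(u,v)\le f(v)\}$. The cost is $\sigma(f)=\sum_v f(v)$. $f$ is dominating if $|H_f(u)|\ge1$ for all $u\in V$; it is a minimal dominating broadcast if no dominating broadcast $g\ne f$ satisfies $g\le f$ pointwise. $\Gamma_b(G)$ is the maximum cost of a minimal dominating broadcast on $G$. *)

theory Defs
  imports "Graph_Theory.Graph_Theory" "HOL-Library.FuncSet"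
begin

text \<open>
  A simple undirected graph is a digraph satisfying the locale \<open>graph\<close>: every edge is
  represented by its two opposite arcs.  Distances are shortest-path lengths for unit
  arc weights (infinite between different components), eccentricities and diameters are
  the corresponding suprema.
\<close>

definition gdist :: "('a, 'b) pre_digraph \<Rightarrow> 'a \<Rightarrow> 'a \<Rightarrow> ereal" where
  "gdist G u v = wf_digraph.\<mu> G (\<lambda>_. 1) u v"

definition ecc :: "('a, 'b) pre_digraph \<Rightarrow> 'a \<Rightarrow> ereal" where
  "ecc G v = (SUP u\<in>verts G. gdist G v u)"

definition diam :: "('a, 'b) pre_digraph \<Rightarrow> ereal" where
  "diam G = (SUP v\<in>verts G. ecc G v)"

text \<open>
  Broadcasts are extensional functions on the vertex set, so that equality of broadcasts
  is agreement on all vertices.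
\<close>

definition broadcast :: "('a, 'b) pre_digraph \<Rightarrow> ('a \<Rightarrow> nat) \<Rightarrow> bool" where
  "broadcast G f \<longleftrightarrow>
     f \<in> verts G \<rightarrow>\<^sub>E {k. ereal (real k) \<le> diam G} \<and>
     (\<forall>v\<in>verts G. ereal (real (f v)) \<le> ecc G v)"

definition broadcast_verts :: "('a, 'b) pre_digraph \<Rightarrow> ('a \<Rightarrow> nat) \<Rightarrow> 'a set" where
  "broadcast_verts G f = {v \<in> verts G. f v > 0}"

definition heard_by :: "('a, 'b) pre_digraph \<Rightarrow> ('a \<Rightarrow> nat) \<Rightarrow> 'a \<Rightarrow> 'a set" where
  "heard_by G f u = {v \<in> broadcast_verts G f. gdist G u v \<le> ereal (real (f v))}"

definition cost :: "('a, 'b) pre_digraph \<Rightarrow> ('a \<Rightarrow> nat) \<Rightarrow> nat" where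
  "cost G f = (\<Sum>v\<in>verts G. f v)"

definition dominating_broadcast :: "('a, 'b) pre_digraph \<Rightarrow> ('a \<Rightarrow> nat) \<Rightarrow> bool" where
  "dominating_broadcast G f \<longleftrightarrow>
     broadcast G f \<and> (\<forall>u\<in>verts G. card (heard_by G f u) \<ge> 1)"

definition minimal_dominating_broadcast ::
    "('a, 'b) pre_digraph \<Rightarrow> ('a \<Rightarrow> nat) \<Rightarrow> bool" where
  "minimal_dominating_broadcast G f \<longleftrightarrow>
     dominating_broadcast G f \<and>
     \<not> (\<exists>g. dominating_broadcast G g \<and> g \<noteq> f \<and> (\<forall>v\<in>verts G. g v \<le> f v))"

definition upper_broadcast_number :: "('a, 'b) pre_digraph \<Rightarrow> nat" (\<open>\<Gamma>\<^sub>b\<close>) where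
  "\<Gamma>\<^sub>b G = Max {cost G f | f. minimal_dominating_broadcast G f}"

definition cycle_graph :: "nat \<Rightarrow> nat pair_pre_digraph" where
  "cycle_graph n =
     \<lparr> pverts = {0..<n},
       parcs = {(i, j). i < n \<and> j < n \<and> (j = Suc i mod n \<or> i = Suc j mod n)} \<rparr>"

lemma pair_graph_cycle_graph:
  assumes "n \<ge> 3"
  shows "pair_graph (cycle_graph n)"
proof
  show "finite (parcs (cycle_graph n))"
    by (rule finite_subset[of _ "{0..<n} \<times> {0..<n}"]) (auto simp: cycle_graph_def)
  show "fst e \<noteq> snd e" if "e \<in> parcs (cycle_graph n)" for e
    using that assms by (auto simp: cycle_graph_def mod_Suc split: if_splits)
  show "symmetric (with_proj (cycle_graph n))"
    by (auto simp: cycle_graph_def symmetric_def arcs_ends_def arc_to_ends_def intro!: symI)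
qed (auto simp: cycle_graph_def)

end

theory Submission
  imports Defs
begin

text \<open>
  Write \<open>m = n div 2\<close>.  Weight \<open>m - 1\<close> on two vertices at distance \<open>1\<close> (\<open>n\<close> even) or \<open>2\<close>
  (\<open>n\<close> odd) is a minimal dominating broadcast of cost \<open>2 (m - 1)\<close>.

  Conversely, let \<open>f\<close> be minimal with \<open>k\<close> broadcasting vertices.  By minimality each of them has
  a private listener, that is, a vertex that hears it alone.  All distances are at most \<open>m\<close>, so
  for \<open>k \<ge> 2\<close> no vertex has weight \<open>m\<close>, which settles \<open>k \<le> 2\<close>.  If three arcs of a cycle
  share a vertex, then one of them lies in the union of the two others; hence every vertex hears
  at most two broadcasts, and the \<open>k\<close> private listeners hear one.  Counting pairs of a broadcast
  and a listener gives \<open>\<Sum> (2 f v + 1) \<le> 2 n - k\<close>, i.e. cost at most \<open>n - k \<le> 2 (m - 1)\<close>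
  for \<open>k \<ge> 3\<close>.
\<close>

section \<open>Distances in cycles\<close>

text \<open>Length of the shorter of the two arcs between vertices \<open>u\<close> and
  \<open>v\<close>; the detour through \<open>int\<close> avoids truncated subtraction.\<close>

definition cdist :: "nat \<Rightarrow> nat \<Rightarrow> nat \<Rightarrow> nat" where
  "cdist n u v = (let d = nat \<bar>int u - int v\<bar> in min d (n - d))"

lemma int_cdist:
  assumes "u < n" "v < n"
  shows "int (cdist n u v) = min \<bar>int u - int v\<bar> (int n - \<bar>int u - int v\<bar>)"
  using assms unfolding cdist_def Let_def by linarith

lemma cdist_le_half: "cdist n u v \<le> n div 2"
  by (auto simp: cdist_def Let_def)

text \<open>A shift from \<open>v\<close> to \<open>u\<close> is determined up to multiples of
  \<open>n\<close>, and \<open>cdist\<close> is the least absolute value of such a shift. This form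
  turns balls into images of integer intervals.\<close>

lemma cdist_le_iff:
  assumes "u < n" "v < n"
  shows "cdist n u v \<le> k \<longleftrightarrow> (\<exists>s::int. \<bar>s\<bar> \<le> int k \<and> int u = (int v + s) mod int n)"
proof
  assume le: "cdist n u v \<le> k"
  define e where "e = int u - int v"
  have "\<bar>e\<bar> \<le> int k \<or> \<bar>e - int n\<bar> \<le> int k \<or> \<bar>e + int n\<bar> \<le> int k"
    using le assms unfolding cdist_def Let_def e_def by (auto simp: min_def split: if_splits)
  moreover have "int u = (int v + e) mod int n" "int u = (int v + (e - int n)) mod int n"
      "int u = (int v + (e + int n)) mod int n"
    using assms by (auto simp: e_def)
  ultimately show "\<exists>s::int. \<bar>s\<bar> \<le> int k \<and> int u = (int v + s) mod int n"
    by blast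
next
  assume "\<exists>s::int. \<bar>s\<bar> \<le> int k \<and> int u = (int v + s) mod int n"
  then obtain s :: int where s: "\<bar>s\<bar> \<le> int k" "int u = (int v + s) mod int n"
    by blast
  define q where "q = (int v + s) div int n"
  have eq: "s = int u - int v + int n * q"
    using s(2) unfolding q_def by (metis add_diff_cancel_left' add_diff_eq diff_add_eq mult_div_mod_eq add.commute)
  \<comment> \<open>Every shift other than \<open>u - v\<close> itself has absolute value at least
    \<open>n - |u - v|\<close>, the length of the complementary arc.\<close>
  have far: "cdist n u v \<le> k" if "int n - \<bar>int u - int v\<bar> \<le> \<bar>s\<bar>"
  proof -
    have "n - nat \<bar>int u - int v\<bar> \<le> k" using that s(1) by linarith
    then show ?thesis by (simp add: cdist_def Let_def)
  qed
  consider "q = 0" | "q \<ge> 1" | "q \<le> -1" by linarith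
  then show "cdist n u v \<le> k"
  proof cases
    case 1
    then show ?thesis using eq s(1) by (auto simp: cdist_def Let_def)
  next
    case 2
    then have "int n * 1 \<le> int n * q" by (intro mult_left_mono) auto
    then show ?thesis using eq by (intro far) linarith
  next
    case 3
    then have "int n * q \<le> int n * (-1)" by (intro mult_left_mono) auto
    then show ?thesis using eq by (intro far) linarith
  qed
qed

section \<open>Balls as arcs of the cycle\<close>

definition cball :: "nat \<Rightarrow> nat \<Rightarrow> nat \<Rightarrow> nat set" where
  "cball n v k = {u. u < n \<and> cdist n u v \<le> k}"

lemma cball_conv_image:
  assumes "v < n"
  shows "cball n v k = (\<lambda>s. nat ((int v + s) mod int n)) ` {- int k..int k}"
proof -
  have "u \<in> cball n v k \<longleftrightarrow> u \<in> (\<lambda>s. nat ((int v + s) mod int n)) ` {- int k..int k}" for u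
  proof
    assume "u \<in> cball n v k"
    then obtain s where "\<bar>s\<bar> \<le> int k" "int u = (int v + s) mod int n"
      using cdist_le_iff[of u n v k] assms by (auto simp: cball_def)
    then show "u \<in> (\<lambda>s. nat ((int v + s) mod int n)) ` {- int k..int k}"
      by (intro image_eqI[of _ _ s]) (metis nat_int, simp add: abs_le_iff)
  next
    assume "u \<in> (\<lambda>s. nat ((int v + s) mod int n)) ` {- int k..int k}"
    then obtain s where s: "s \<in> {- int k..int k}" "u = nat ((int v + s) mod int n)" by blast
    have "0 \<le> (int v + s) mod int n" "(int v + s) mod int n < int n"
      using assms by auto
    with s have "u < n" "\<bar>s\<bar> \<le> int k" "int u = (int v + s) mod int n"
      by (auto simp: abs_le_iff)
    then show "u \<in> cball n v k"
      using cdist_le_iff[of u n v k] assms by (auto simp: cball_def)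
  qed
  then show ?thesis by blast
qed

text \<open>Two shifts in the interval differ by at most \<open>2 * k < n\<close>, so they are
  congruent modulo \<open>n\<close> only when equal: the arc does not overlap itself.\<close>

lemma card_cball:
  assumes "v < n" "2 * k + 1 \<le> n"
  shows "card (cball n v k) = 2 * k + 1"
proof -
  have "inj_on (\<lambda>s. nat ((int v + s) mod int n)) {- int k..int k}"
  proof (rule inj_onI)
    fix s t
    assume st: "s \<in> {- int k..int k}" "t \<in> {- int k..int k}"
      and eq: "nat ((int v + s) mod int n) = nat ((int v + t) mod int n)"
    have "(int v + s) mod int n = (int v + t) mod int n"
      using eq assms(1) by (simp add: eq_nat_nat_iff)
    then have "int n dvd s - t"
      by (metis add_diff_cancel_left mod_eq_dvd_iff)
    moreover have "\<bar>s - t\<bar> < int n" using st assms(2) by auto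
    ultimately show "s = t" using dvd_imp_le_int[of "s - t" "int n"] by fastforce
  qed
  then show ?thesis using assms(1) by (simp add: cball_conv_image card_image)
qed

text \<open>Arcs through a common point \<open>x\<close> can all be lifted to the integers with
  \<open>x\<close> as origin; they become intervals containing \<open>0\<close>, comparable by their
  end points alone.\<close>

lemma cball_through_point:
  assumes "x < n" "v < n" "x \<in> cball n v k"
  obtains a b :: int where "a \<le> 0" "0 \<le> b"
    "cball n v k = (\<lambda>r. nat ((int x + r) mod int n)) ` {a..b}"
proof -
  obtain s where s: "\<bar>s\<bar> \<le> int k" "int x = (int v + s) mod int n"
    using assms cdist_le_iff[of x n v k] by (auto simp: cball_def)
  have "(int x + r) mod int n = (int v + (s + r)) mod int n" for r
    unfolding s(2) by (simp add: mod_add_left_eq add.assoc)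
  then have "(\<lambda>r. nat ((int x + r) mod int n)) ` {- int k - s..int k - s}
      = (\<lambda>t. nat ((int v + t) mod int n)) ` ((\<lambda>r. s + r) ` {- int k - s..int k - s})"
    by (simp only: image_image)
  also have "(\<lambda>r. s + r) ` {- int k - s..int k - s} = {- int k..int k}"
    by simp
  finally have "cball n v k = (\<lambda>r. nat ((int x + r) mod int n)) ` {- int k - s..int k - s}"
    using cball_conv_image[OF assms(2)] by simp
  then show ?thesis using s(1) by (intro that[of "- int k - s" "int k - s"]) auto
qed

lemma three_cballs_through_point:
  assumes "x < n" "v1 < n" "v2 < n" "v3 < n"
    and "x \<in> cball n v1 k1" "x \<in> cball n v2 k2" "x \<in> cball n v3 k3"
  shows "cball n v1 k1 \<subseteq> cball n v2 k2 \<union> cball n v3 k3 \<or>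
         cball n v2 k2 \<subseteq> cball n v1 k1 \<union> cball n v3 k3 \<or>
         cball n v3 k3 \<subseteq> cball n v1 k1 \<union> cball n v2 k2"
proof -
  let ?h = "\<lambda>r. nat ((int x + r) mod int n)"
  obtain a1 b1 where 1: "a1 \<le> 0" "0 \<le> b1" "cball n v1 k1 = ?h ` {a1..b1}"
    using cball_through_point[of x n v1 k1] assms by metis
  obtain a2 b2 where 2: "a2 \<le> 0" "0 \<le> b2" "cball n v2 k2 = ?h ` {a2..b2}"
    using cball_through_point[of x n v2 k2] assms by metis
  obtain a3 b3 where 3: "a3 \<le> 0" "0 \<le> b3" "cball n v3 k3 = ?h ` {a3..b3}"
    using cball_through_point[of x n v3 k3] assms by metis
  \<comment> \<open>Discard an arc other than the one reaching furthest left and the one reaching furthest right.\<close>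
  have "(min a2 a3 \<le> a1 \<and> b1 \<le> max b2 b3) \<or> (min a1 a3 \<le> a2 \<and> b2 \<le> max b1 b3) \<or>
        (min a1 a2 \<le> a3 \<and> b3 \<le> max b1 b2)"
    by linarith
  \<comment> \<open>All three intervals contain \<open>0\<close>, so the union of two of them has no
    gap and is fixed by its extreme end points.\<close>
  then have "{a1..b1} \<subseteq> {a2..b2} \<union> {a3..b3} \<or> {a2..b2} \<subseteq> {a1..b1} \<union> {a3..b3} \<or>
      {a3..b3} \<subseteq> {a1..b1} \<union> {a2..b2}"
    using 1(1,2) 2(1,2) 3(1,2)
    by (elim disjE) (force intro: disjI1, force intro: disjI1 disjI2, force intro: disjI2)
  then show ?thesis unfolding 1(3) 2(3) 3(3) by blast
qed

section \<open>Cyclic distance as graph distance\<close>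

lemma cdist_arc_le:
  assumes "(u, w) \<in> parcs (cycle_graph n)" "v < n"
  shows "cdist n u v \<le> Suc (cdist n w v)"
proof -
  have uw: "u < n" "w < n" "w = Suc u mod n \<or> u = Suc w mod n"
    using assms(1) by (auto simp: cycle_graph_def)
  \<comment> \<open>The last two cases are the arc that closes the cycle between
    \<open>n - 1\<close> and \<open>0\<close>.\<close>
  then have "int w = int u + 1 \<or> int u = int w + 1 \<or> int w = 0 \<and> int u + 1 = int n \<or>
      int u = 0 \<and> int w + 1 = int n"
    by (auto simp: mod_Suc split: if_splits)
  then have "int (cdist n u v) \<le> int (cdist n w v) + 1"
    unfolding int_cdist[OF uw(1) assms(2)] int_cdist[OF uw(2) assms(2)]
    using uw(1,2) assms(2) by (smt (verit) of_nat_less_iff of_nat_0_le_iff)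
  then show ?thesis by linarith
qed

lemma cdist_pred:
  assumes "u < n" "v < n" "cdist n u v = Suc k"
  obtains w where "(u, w) \<in> parcs (cycle_graph n)" "cdist n w v = k"
proof -
  \<comment> \<open>Cyclic successor and predecessor, with conditionals in place of
    \<open>mod\<close> to stay within linear arithmetic; the neighbour on a shorter arc to
    \<open>v\<close> is nearer to it.\<close>
  let ?s = "if Suc u = n then 0 else Suc u" and ?p = "if u = 0 then n - 1 else u - 1"
  have s: "int ?s = (if int u + 1 = int n then 0 else int u + 1)" "?s < n"
    and p: "int ?p = (if int u = 0 then int n - 1 else int u - 1)" "?p < n"
    using assms(1) by auto
  have "(u, ?s) \<in> parcs (cycle_graph n)" "(u, ?p) \<in> parcs (cycle_graph n)"
    using assms(1) by (auto simp: cycle_graph_def mod_Suc)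
  moreover have "int (cdist n ?s v) = int k \<or> int (cdist n ?p v) = int k"
    unfolding int_cdist[OF s(2) assms(2)] int_cdist[OF p(2) assms(2)] s(1) p(1)
    using int_cdist[OF assms(1,2)] assms
    by (smt (verit) of_nat_less_iff of_nat_0_le_iff of_nat_Suc)
  ultimately show ?thesis using that by auto
qed

text \<open>One arc lowers \<open>cdist\<close> by at most one, so no walk is shorter; descending
  one unit at a time builds a walk that attains it.\<close>

lemma gdist_cycle_graph:
  assumes "n \<ge> 3" "u < n" "v < n"
  shows "gdist (with_proj (cycle_graph n)) u v = ereal (real (cdist n u v))"
proof -
  interpret pair_graph "cycle_graph n" using assms(1) by (rule pair_graph_cycle_graph)
  have cost: "awalk_cost (\<lambda>_. 1) p = real (length p)" for p :: "(nat \<times> nat) list"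
    by (induction p) auto
  have lower: "cdist n u v \<le> length p" if "awalk u p v" for p u
    using that
  proof (induction p arbitrary: u)
    case Nil
    then show ?case by (auto simp: awalk_Nil_iff cdist_def)
  next
    case (Cons e p)
    then have "(u, snd e) \<in> parcs (cycle_graph n)" "cdist n (snd e) v \<le> length p"
      by (auto simp: awalk_Cons_iff)
    with cdist_arc_le[of u "snd e" n v] assms(3) show ?case by auto
  qed
  have "\<exists>p. awalk u p v \<and> length p = k" if "cdist n u v = k" "u < n" for k u
    using that
  proof (induction k arbitrary: u)
    case 0
    then have "u = v" using assms(3) by (auto simp: cdist_def Let_def min_def split: if_splits)
    moreover have "v \<in> pverts (cycle_graph n)" using assms(3) by (simp add: cycle_graph_def)
    ultimately show ?case by (auto simp: awalk_Nil_iff)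
  next
    case (Suc k)
    then obtain w where w: "(u, w) \<in> parcs (cycle_graph n)" "cdist n w v = k"
      using cdist_pred assms(3) by metis
    then have "w < n" by (auto simp: cycle_graph_def)
    then obtain p where "awalk w p v" "length p = k" using Suc.IH w(2) by blast
    then have "awalk u ((u, w) # p) v" "length ((u, w) # p) = Suc k"
      using w(1) by (auto simp: awalk_Cons_iff)
    then show ?case by blast
  qed
  then obtain p where p: "awalk u p v" "length p = cdist n u v" using assms(2) by blast
  have "\<mu> (\<lambda>_. 1) u v = ereal (real (cdist n u v))"
  proof (rule antisym)
    show "\<mu> (\<lambda>_. 1) u v \<le> ereal (real (cdist n u v))"
      using min_cost_le_walk_cost[OF p(1), of "\<lambda>_. 1"] p(2) by (simp add: cost)
    show "ereal (real (cdist n u v)) \<le> \<mu> (\<lambda>_. 1) u v"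
      unfolding \<mu>_def using lower by (intro INF_greatest) (auto simp: cost)
  qed
  then show ?thesis by (simp add: gdist_def)
qed

section \<open>Private listeners\<close>

text \<open>Silencing \<open>v\<close> leaves a smaller broadcast, which by minimality misses some
  \<open>u\<close>; as \<open>f\<close> does reach \<open>u\<close>, only \<open>v\<close> is heard
  there.\<close>

lemma minimal_dominating_broadcast_private:
  assumes min: "minimal_dominating_broadcast G f" and fin: "finite (verts G)"
    and v: "v \<in> broadcast_verts G f"
  obtains u where "u \<in> verts G" "heard_by G f u = {v}"
proof -
  let ?g = "f(v := 0)"
  have dom: "dominating_broadcast G f"
    using min by (simp add: minimal_dominating_broadcast_def)
  have vV: "v \<in> verts G" "f v > 0" using v by (auto simp: broadcast_verts_def)
  have bf: "broadcast G f" using dom by (simp add: dominating_broadcast_def)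
  have "ereal (real (f v)) \<le> diam G" "ereal (real (f v)) \<le> ecc G v"
    using bf vV by (auto simp: broadcast_def)
  \<comment> \<open>The value \<open>0\<close> is admissible at \<open>v\<close> only if these
    suprema are nonnegative, which they inherit from the bound on \<open>f v\<close>.\<close>
  then have "0 \<le> diam G" "0 \<le> ecc G v"
    by (meson ereal_less_eq(5) of_nat_0_le_iff order_trans)+
  with bf vV have bg: "broadcast G ?g"
    unfolding broadcast_def by (auto simp: PiE_iff extensional_def zero_ereal_def[symmetric])
  have "?g \<noteq> f" using vV by (auto simp: fun_eq_iff)
  moreover have "\<forall>x\<in>verts G. ?g x \<le> f x" by simp
  ultimately have "\<not> dominating_broadcast G ?g"
    using min unfolding minimal_dominating_broadcast_def by blast
  then obtain u where u: "u \<in> verts G" "card (heard_by G ?g u) = 0"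
    using bg by (auto simp: dominating_broadcast_def not_le)
  have heard: "heard_by G ?g u = heard_by G f u - {v}"
    by (auto simp: heard_by_def broadcast_verts_def)
  \<comment> \<open>\<open>card\<close> is \<open>0\<close> on infinite sets as well, so finiteness
    is needed to read \<open>u(2)\<close> as emptiness.\<close>
  have "finite (heard_by G f u)"
    using fin by (auto simp: heard_by_def broadcast_verts_def)
  then have "heard_by G f u \<subseteq> {v}" using u(2) heard by auto
  moreover have "heard_by G f u \<noteq> {}"
    using dom u(1) by (force simp: dominating_broadcast_def)
  ultimately show ?thesis using that u(1) by blast
qed

section \<open>Broadcasts on cycles\<close>

lemma verts_cycle_graph:
  "verts (with_proj (cycle_graph n)) = {0..<n}" "pverts (cycle_graph n) = {0..<n}"
  by (simp_all add: cycle_graph_def)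

lemma mem_heard_by_cycle_graph:
  assumes "n \<ge> 3" "u < n"
  shows "v \<in> heard_by (with_proj (cycle_graph n)) f u \<longleftrightarrow> v < n \<and> 0 < f v \<and> u \<in> cball n v (f v)"
  using assms by (auto simp: heard_by_def broadcast_verts_def verts_cycle_graph gdist_cycle_graph cball_def)

text \<open>Every vertex has an antipode at distance \<open>n div 2\<close>, the largest possible,
  so all eccentricities and the diameter equal \<open>n div 2\<close>.\<close>

lemma broadcast_cycle_graph_iff:
  assumes "n \<ge> 3"
  shows "broadcast (with_proj (cycle_graph n)) f \<longleftrightarrow>
    f \<in> extensional {0..<n} \<and> (\<forall>v<n. f v \<le> n div 2)"
proof -
  let ?G = "with_proj (cycle_graph n)"
  have ecc: "ecc ?G v = ereal (real (n div 2))" if "v < n" for v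
    unfolding ecc_def verts_cycle_graph
  proof (rule antisym)
    show "(SUP u\<in>{0..<n}. gdist ?G v u) \<le> ereal (real (n div 2))"
      using that assms cdist_le_half[of n v] by (intro SUP_least) (simp add: gdist_cycle_graph)
    let ?u = "if v < n div 2 then v + n div 2 else v - n div 2"
    have "?u < n" using that by auto
    moreover have "cdist n v ?u = n div 2" using that by (auto simp: cdist_def Let_def min_def)
    ultimately show "ereal (real (n div 2)) \<le> (SUP u\<in>{0..<n}. gdist ?G v u)"
      using that assms by (intro SUP_upper2[of ?u]) (auto simp only: gdist_cycle_graph atLeastLessThan_iff)
  qed
  have "diam ?G = (SUP v\<in>{0..<n}. ereal (real (n div 2)))"
    unfolding diam_def verts_cycle_graph by (intro SUP_cong) (auto simp: ecc)
  then have "diam ?G = ereal (real (n div 2))"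
    using assms by simp
  then show ?thesis
    using ecc by (auto simp: broadcast_def verts_cycle_graph PiE_iff)
qed

lemma dominating_broadcast_cycle_graph_iff:
  assumes "n \<ge> 3"
  shows "dominating_broadcast (with_proj (cycle_graph n)) f \<longleftrightarrow>
    f \<in> extensional {0..<n} \<and> (\<forall>v<n. f v \<le> n div 2) \<and>
    (\<forall>u<n. \<exists>v<n. 0 < f v \<and> cdist n u v \<le> f v)"
proof -
  have "card (heard_by (with_proj (cycle_graph n)) f u) \<ge> 1 \<longleftrightarrow>
      (\<exists>v<n. 0 < f v \<and> cdist n u v \<le> f v)" if "u < n" for u
  proof -
    have "finite (heard_by (with_proj (cycle_graph n)) f u)"
      by (auto simp: heard_by_def broadcast_verts_def verts_cycle_graph)
    then have "card (heard_by (with_proj (cycle_graph n)) f u) \<ge> 1 \<longleftrightarrow>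
        (\<exists>v. v \<in> heard_by (with_proj (cycle_graph n)) f u)"
      by (auto simp: Suc_le_eq card_gt_0_iff)
    then show ?thesis using that assms by (auto simp: mem_heard_by_cycle_graph cball_def)
  qed
  then show ?thesis
    using assms
    by (auto simp: dominating_broadcast_def broadcast_cycle_graph_iff verts_cycle_graph)
qed

section \<open>The upper bound\<close>

lemma cost_cycle_graph_le:
  assumes n: "n \<ge> 4" and min: "minimal_dominating_broadcast (with_proj (cycle_graph n)) f"
  shows "cost (with_proj (cycle_graph n)) f \<le> 2 * (n div 2 - 1)"
proof -
  let ?G = "with_proj (cycle_graph n)"
  define B where "B = broadcast_verts ?G f"
  have B_iff: "v \<in> B \<longleftrightarrow> v < n \<and> 0 < f v" for v
    by (auto simp: B_def broadcast_verts_def verts_cycle_graph)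
  have finB: "finite B" by (rule finite_subset[of _ "{0..<n}"]) (auto simp: B_iff)
  have heard: "v \<in> heard_by ?G f u \<longleftrightarrow> v \<in> B \<and> u \<in> cball n v (f v)" if "u < n" for u v
    using mem_heard_by_cycle_graph[of n u v f] n that by (auto simp: B_iff)
  have le_half: "f v \<le> n div 2" if "v < n" for v
    using min n that
    by (auto simp: minimal_dominating_broadcast_def dominating_broadcast_def broadcast_cycle_graph_iff)
  have cost: "cost ?G f = (\<Sum>v\<in>B. f v)"
    unfolding cost_def verts_cycle_graph by (rule sum.mono_neutral_right) (auto simp: B_iff)
  have "\<forall>v\<in>B. \<exists>u. u < n \<and> heard_by ?G f u = {v}"
    using minimal_dominating_broadcast_private[OF min]
    by (metis B_def atLeastLessThan_iff finite_atLeastLessThan verts_cycle_graph)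
  then obtain p where p: "\<And>v. v \<in> B \<Longrightarrow> p v < n" "\<And>v. v \<in> B \<Longrightarrow> heard_by ?G f (p v) = {v}"
    by metis
  \<comment> \<open>Hence no ball lies in a union of other balls: \<open>p v\<close> belongs to the
    ball of \<open>v\<close> alone.\<close>
  have only_v: "p v \<in> cball n w (f w) \<longleftrightarrow> w = v" if "v \<in> B" "w \<in> B" for v w
    using heard[OF p(1)[OF that(1)], of w] p(2)[OF that(1)] that by auto
  show ?thesis
  proof (cases "card B \<le> 1")
    case True
    then have "(\<Sum>v\<in>B. f v) \<le> 1 * (n div 2)"
      using sum_bounded_above[of B f "n div 2"] le_half
      by (metis B_iff mult_le_mono1 of_nat_id order_trans)
    \<comment> \<open>\<open>n \<ge> 4\<close> gives
      \<open>n div 2 \<le> 2 * (n div 2 - 1)\<close>.\<close>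
    then show ?thesis using cost n by linarith
  next
    case False
    have le: "f v \<le> n div 2 - 1" if "v \<in> B" for v
    proof -
      obtain w where w: "w \<in> B" "w \<noteq> v"
        using False card_le_Suc0_iff_eq[OF finB] that by auto
      then have "p w \<notin> cball n v (f v)" using only_v that by auto
      then have "\<not> cdist n (p w) v \<le> f v" using p(1)[OF w(1)] by (simp add: cball_def)
      then show ?thesis using cdist_le_half[of n "p w" v] by linarith
    qed
    show ?thesis
    proof (cases "card B = 2")
      case True
      then show ?thesis using sum_bounded_above[of B f "n div 2 - 1"] le cost by simp
    next
      case ne2: False
      have at_most_two: "card (heard_by ?G f u) \<le> 2" if u: "u < n" for u
      proof (rule ccontr)
        assume "\<not> card (heard_by ?G f u) \<le> 2"
        then have "3 \<le> card (heard_by ?G f u)" by simp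
        then obtain T where "T \<subseteq> heard_by ?G f u" "card T = 3"
          by (meson obtain_subset_with_card_n)
        then obtain v1 v2 v3 where d: "v1 \<noteq> v2" "v2 \<noteq> v3" "v1 \<noteq> v3"
            and h: "v1 \<in> heard_by ?G f u" "v2 \<in> heard_by ?G f u" "v3 \<in> heard_by ?G f u"
          by (auto simp: card_3_iff)
        have b: "v1 \<in> B" "v2 \<in> B" "v3 \<in> B" using h heard[OF u] by auto
        then have "cball n v1 (f v1) \<subseteq> cball n v2 (f v2) \<union> cball n v3 (f v3) \<or>
         cball n v2 (f v2) \<subseteq> cball n v1 (f v1) \<union> cball n v3 (f v3) \<or>
         cball n v3 (f v3) \<subseteq> cball n v1 (f v1) \<union> cball n v2 (f v2)"
          using h heard[OF u] by (intro three_cballs_through_point[OF u]) (auto simp: B_iff)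
        \<comment> \<open>The private listener of the vertex whose ball is covered would hear a
          second broadcast.\<close>
        then show False using only_v b d by blast
      qed
      have "card B \<ge> 3" using False ne2 by linarith
      have inj: "inj_on p B" using p(2) by (metis inj_onI singleton_inject)
      have "(\<Sum>v\<in>B. 2 * f v + 1) = (\<Sum>v\<in>B. card {u \<in> {0..<n}. u \<in> cball n v (f v)})"
      proof (rule sum.cong[OF refl])
        fix v assume v: "v \<in> B"
        have "{u \<in> {0..<n}. u \<in> cball n v (f v)} = cball n v (f v)" by (auto simp: cball_def)
        \<comment> \<open>Excluding weight \<open>n div 2\<close> is what keeps the ball from
          overlapping itself.\<close>
        moreover have "2 * f v + 1 \<le> n" using le[OF v] n by linarith
        ultimately show "2 * f v + 1 = card {u \<in> {0..<n}. u \<in> cball n v (f v)}"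
          using card_cball v by (simp add: B_iff)
      qed
      also have "\<dots> = (\<Sum>u\<in>{0..<n}. card {v \<in> B. u \<in> cball n v (f v)})"
        using finB by (intro sum_multicount_gen[symmetric]) auto
      also have "\<dots> = (\<Sum>u\<in>{0..<n}. card (heard_by ?G f u))"
      proof (rule sum.cong[OF refl])
        fix u assume "u \<in> {0..<n}"
        then have "{v \<in> B. u \<in> cball n v (f v)} = heard_by ?G f u" using heard[of u] by auto
        then show "card {v \<in> B. u \<in> cball n v (f v)} = card (heard_by ?G f u)" by simp
      qed
      finally have count: "(\<Sum>v\<in>B. 2 * f v + 1) = (\<Sum>u\<in>{0..<n}. card (heard_by ?G f u))" .
      \<comment> \<open>\<open>card B\<close> is written as a sum of indicators so that the bound
        \<open>2\<close> holds pointwise: private listeners contribute \<open>1 + 1\<close>, other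
        vertices at most \<open>2 + 0\<close>.\<close>
      have "card B = card (p ` B)" using inj by (simp add: card_image)
      also have "\<dots> = (\<Sum>u\<in>{0..<n}. if u \<in> p ` B then 1 else 0)"
        using p(1) by (simp add: sum.If_cases Int_absorb1 image_subset_iff)
      finally have "(\<Sum>v\<in>B. 2 * f v + 1) + card B =
          (\<Sum>u\<in>{0..<n}. card (heard_by ?G f u) + (if u \<in> p ` B then 1 else 0))"
        unfolding count by (simp only: sum.distrib)
      also have "\<dots> \<le> (\<Sum>u\<in>{0..<n}. 2)"
        using at_most_two p(2) by (intro sum_mono) auto
      finally have "(\<Sum>v\<in>B. 2 * f v + 1) + card B \<le> 2 * n" by simp
      moreover have "(\<Sum>v\<in>B. 2 * f v + 1) = 2 * (\<Sum>v\<in>B. f v) + card B"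
        unfolding sum.distrib by (simp add: sum_distrib_left)
      \<comment> \<open>The cost is at most \<open>n - card B \<le> n - 3\<close>, which equals
        \<open>2 * (n div 2 - 1)\<close> for odd \<open>n\<close> and is smaller for even
        \<open>n\<close>.\<close>
      ultimately show ?thesis using \<open>card B \<ge> 3\<close> cost by linarith
    qed
  qed
qed

section \<open>A broadcast attaining the bound\<close>

lemma cycle_graph_extremal_broadcast:
  assumes n: "n \<ge> 4"
  obtains f where "minimal_dominating_broadcast (with_proj (cycle_graph n)) f"
    "cost (with_proj (cycle_graph n)) f = 2 * (n div 2 - 1)"
proof -
  let ?G = "with_proj (cycle_graph n)"
  define r where "r = n div 2 - 1"
  \<comment> \<open>Chosen so that \<open>n = 2 * r + 1 + w\<close>: the ball of radius
    \<open>r\<close> about \<open>0\<close> misses exactly \<open>w\<close> consecutive vertices,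
    and moving its centre by \<open>w\<close> covers them.\<close>
  define w where "w = 1 + n mod 2"
  \<comment> \<open>The value \<open>undefined\<close> off the vertex set makes \<open>f\<close>
    extensional.\<close>
  define f where "f = (\<lambda>v. if v < n then if v = 0 \<or> v = w then r else 0 else undefined)"
  have w: "0 < w" "w < n" and r: "0 < r" using n by (auto simp: w_def r_def)
  have n_eq: "n = 2 * r + 1 + w" using n unfolding w_def r_def by presburger
  have w2: "w \<le> 2" by (auto simp: w_def)
  have f0: "f 0 = r" and fw: "f w = r" and f_other: "\<And>v. v < n \<Longrightarrow> v \<noteq> 0 \<Longrightarrow> v \<noteq> w \<Longrightarrow> f v = 0"
    using w by (auto simp: f_def)
  have cover: "cdist n u 0 \<le> r \<or> cdist n u w \<le> r" if "u < n" for u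
    using that w r w2 unfolding n_eq by (auto simp: cdist_def Let_def min_def)
  have dom: "dominating_broadcast ?G f"
  proof -
    have "f \<in> extensional {0..<n}" by (auto simp: f_def extensional_def)
    moreover have "\<forall>v<n. f v \<le> n div 2" by (auto simp: f_def r_def)
    moreover have "\<exists>v<n. 0 < f v \<and> cdist n u v \<le> f v" if "u < n" for u
      using cover[OF that]
    proof
      assume "cdist n u 0 \<le> r"
      then show ?thesis using f0 r w by (intro exI[of _ 0]) simp
    next
      assume "cdist n u w \<le> r"
      then show ?thesis using fw r w by (intro exI[of _ w]) simp
    qed
    ultimately show ?thesis using n by (simp add: dominating_broadcast_cycle_graph_iff)
  qed
  \<comment> \<open>The reflection of the cycle that swaps \<open>0\<close> and \<open>w\<close>
    also swaps \<open>r + w\<close> and \<open>n - r\<close>, the latter being \<open>-r\<close>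
    modulo \<open>n\<close>.\<close>
  have far: "cdist n (r + w) 0 = r + 1" "cdist n (r + w) w = r"
      "cdist n (n - r) 0 = r" "cdist n (n - r) w = r + 1"
    using w2 r w(1) unfolding n_eq by (auto simp: cdist_def Let_def min_def)
  have "g = f" if g: "dominating_broadcast ?G g" "\<forall>v\<in>verts ?G. g v \<le> f v" for g
  proof -
    have ext: "g \<in> extensional {0..<n}"
      and cov: "\<And>u. u < n \<Longrightarrow> \<exists>v<n. 0 < g v \<and> cdist n u v \<le> g v"
      using g(1) n by (auto simp: dominating_broadcast_cycle_graph_iff)
    have le: "g v \<le> f v" if "v < n" for v using g(2) that by (auto simp: verts_cycle_graph)
    have g_other: "g v = 0" if "v < n" "v \<noteq> 0" "v \<noteq> w" for v
      using le[OF that(1)] f_other[OF that] by simp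
    have le0: "g 0 \<le> r" and lew: "g w \<le> r" using le[of 0] le[of w] f0 fw w by auto
    \<comment> \<open>\<open>r + w\<close> is a private listener of \<open>w\<close>, and \<open>n - r\<close> of \<open>0\<close>, both at distance exactly \<open>r\<close>.\<close>
    obtain v where v: "v < n" "0 < g v" "cdist n (r + w) v \<le> g v"
      using cov[of "r + w"] n_eq r by auto
    then have "v = w" using g_other[of v] far(1) le0 by force
    then have gw: "g w = r" using v far(2) lew by simp
    obtain v' where v': "v' < n" "0 < g v'" "cdist n (n - r) v' \<le> g v'"
      using cov[of "n - r"] n r by auto
    then have "v' = 0" using g_other[of v'] far(4) lew by force
    then have g0: "g 0 = r" using v' far(3) le0 by simp
    show "g = f"
    proof
      fix v show "g v = f v"
        using ext g0 gw g_other[of v] by (auto simp: f_def extensional_def)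
    qed
  qed
  with dom have "minimal_dominating_broadcast ?G f"
    by (auto simp: minimal_dominating_broadcast_def)
  moreover have "cost ?G f = (\<Sum>v\<in>{0, w}. f v)"
    unfolding cost_def verts_cycle_graph
    using w f_other by (intro sum.mono_neutral_right) auto
  then have "cost ?G f = 2 * (n div 2 - 1)"
    using w f0 fw unfolding r_def[symmetric] by simp
  ultimately show ?thesis using that by blast
qed

theorem theorem3p4:
  fixes n :: nat
  assumes "n \<ge> 4"
  shows "\<Gamma>\<^sub>b (with_proj (cycle_graph n)) = 2 * (n div 2 - 1)"
  unfolding upper_broadcast_number_def
proof (rule Max_eqI)
  let ?C = "{cost (with_proj (cycle_graph n)) f | f.
    minimal_dominating_broadcast (with_proj (cycle_graph n)) f}"
  show le: "c \<le> 2 * (n div 2 - 1)" if "c \<in> ?C" for c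
    using that cost_cycle_graph_le[OF assms] by blast
  \<comment> \<open>\<open>Max\<close> is meaningful only on finite sets; the upper bound itself
    supplies finiteness.\<close>
  show "finite ?C"
    by (rule finite_subset[of _ "{..2 * (n div 2 - 1)}"]) (use le in auto)
  show "2 * (n div 2 - 1) \<in> ?C"
    using cycle_graph_extremal_broadcast[OF assms] by (metis (mono_tags, lifting) mem_Collect_eq)
qed

end
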